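(* Let $\mathbb{F}=\mathbb{R}$ or $\mathbb{C}$. Let $F=\{f_i\}_{i=1}^k$ be a frame for $\mathbb{F}^n$, and let $G=\{g_i\}_{i=1}^k$ be a dual frame for $F$ such that $\langle f_i,g_i\rangle=C_1$ for all $1\le i\le k$, where $C_1>0$ is a constant, and let $p\ge 1$. Then $$\phi_p(F,G)\ \geq\ \frac{(nk-n^2)^p+n^{2p}(k-1)^{p-1}}{k^{2p-1}(k-1)^{p-1}},$$ with equality if and only if both of the following hold: (i) $G$ is the canonical dual frame of $F$; and (ii) there exists some $C_2>0$ such that $|\langle f_i,g_j\rangle|^2=C_2$ for all $i,j\in\{1,\dots,k\}$ with $i\ne j$.
   Context: A frame for $\mathbb{F}^n$ is a finite sequence $\{f_i\}_{i=1}^k$ ($k\ge n$) of vectors for which there are constants $0<A\le B<\infty$ with $A\|f\|^2\le\sum_{i=1}^k|\langle f,f_i\rangle|^2\le B\|f\|^2$ for all $f\in\mathbb{F}^n$ (equivalently, a spanning sequence). A dual frame for $F=\{f_i\}_{i=1}^k$ is a frame $\{g_i\}_{i=1}^k$ such that $f=\sum_{i=1}^k\langle f,g_i\rangle f_i=\sum_{i=1}^k\langle f,f_i\rangle g_i$ for all $f\in\mathbb{F}^n$. The frame operator of $F$ is $Sf=\sum_{i=1}^k\langle f,f_i\rangle f_i$, which is positive, self-adjoint and invertible; the canonical dual frame of $F$ is $\{S^{-1}f_i\}_{i=1}^k$. The cross $p$-th frame potential of $F$ with respect to a dual frame $G$ is $\phi_p(F,G)=\sum_{i,j=1}^k|\langle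 f_i,g_j\rangle|^{2p}$.
   Formalization: Assumes k≥2 (for k=1 the bound is 0/0 or involves 0^0). "Equality iff (i) and (ii)" is stated for p>1 and k>n; for p=1 or k=n, where equality can hold without (ii) (e.g. F=G an orthonormal basis), it is replaced by "equality iff (i)". *)

theory Defs
  imports "HOL-Analysis.Analysis"
begin

text \<open>
  The class abstracts over the scalar fields \<open>\<real>\<close> and \<open>\<complex>\<close>; both are shown to be instances. These are
  the only ones up to isometric isomorphism: expanding \<open>(x + 1) * scnj (x + 1)\<close> shows that
  \<open>x + scnj x\<close> is a real scalar, so every \<open>x\<close> is a root of a real quadratic polynomial.
  Multiplicativity and involutivity of the conjugation follow from the two axioms.
\<close>

class real_or_complex = real_normed_field +
  fixes scnj :: "'a \<Rightarrow> 'a"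
  assumes scnj_add: "scnj (x + y) = scnj x + scnj y"
    and mult_scnj: "x * scnj x = (norm x)\<^sup>2 *\<^sub>R 1"

instantiation real :: real_or_complex
begin
definition scnj_real :: "real \<Rightarrow> real" where "scnj_real x = x"
instance
  by standard (simp_all add: scnj_real_def power2_eq_square)
end

instantiation complex :: real_or_complex
begin
definition scnj_complex :: "complex \<Rightarrow> complex" where "scnj_complex = cnj"
instance
  by standard
    (simp_all only: scnj_complex_def complex_cnj_add complex_norm_square flip: of_real_def)
end

text \<open>Linear in the first argument. The library norm on \<open>'a ^ 'n\<close> is the one it induces.\<close>

definition hinner :: "'a::real_or_complex ^ 'n \<Rightarrow> 'a ^ 'n \<Rightarrow> 'a" where
  "hinner x y = (\<Sum>i\<in>UNIV. x $ i * scnj (y $ i))"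

lemma hinner_self: "hinner x x = of_real ((norm x)\<^sup>2)"
  by (simp add: hinner_def mult_scnj norm_vec_def L2_set_def sum_nonneg flip: of_real_def)

text \<open>
  A finite sequence of length \<open>k\<close> is a function on \<open>nat\<close>, of which only the values on \<open>{1..k}\<close> matter.
\<close>

definition is_frame :: "nat \<Rightarrow> (nat \<Rightarrow> 'a::real_or_complex ^ 'n) \<Rightarrow> bool" where
  "is_frame k f \<longleftrightarrow> CARD('n) \<le> k \<and>
     (\<exists>A B::real. 0 < A \<and> A \<le> B \<and>
        (\<forall>v. A * (norm v)\<^sup>2 \<le> (\<Sum>i=1..k. (norm (hinner v (f i)))\<^sup>2) \<and>
             (\<Sum>i=1..k. (norm (hinner v (f i)))\<^sup>2) \<le> B * (norm v)\<^sup>2))"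

definition is_dual_frame ::
    "nat \<Rightarrow> (nat \<Rightarrow> 'a::real_or_complex ^ 'n) \<Rightarrow> (nat \<Rightarrow> 'a ^ 'n) \<Rightarrow> bool" where
  "is_dual_frame k f g \<longleftrightarrow> is_frame k g \<and>
     (\<forall>v. v = (\<Sum>i=1..k. hinner v (g i) *s f i) \<and>
          v = (\<Sum>i=1..k. hinner v (f i) *s g i))"

definition frame_operator ::
    "nat \<Rightarrow> (nat \<Rightarrow> 'a::real_or_complex ^ 'n) \<Rightarrow> 'a ^ 'n \<Rightarrow> 'a ^ 'n" where
  "frame_operator k f v = (\<Sum>i=1..k. hinner v (f i) *s f i)"

definition canonical_dual ::
    "nat \<Rightarrow> (nat \<Rightarrow> 'a::real_or_complex ^ 'n) \<Rightarrow> nat \<Rightarrow> 'a ^ 'n" where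
  "canonical_dual k f i = inv (frame_operator k f) (f i)"

definition cross_frame_potential ::
    "real \<Rightarrow> nat \<Rightarrow> (nat \<Rightarrow> 'a::real_or_complex ^ 'n) \<Rightarrow> (nat \<Rightarrow> 'a ^ 'n) \<Rightarrow> real" where
  "cross_frame_potential p k f g =
     (\<Sum>i=1..k. \<Sum>j=1..k. norm (hinner (f i) (g j)) powr (2 * p))"

end

theory Submission imports Defs begin

text \<open>
  The cross Gram matrix with entries \<open>hinner (f i) (g j)\<close> is idempotent with trace \<open>n\<close>, so its constant
  diagonal is \<open>n / k\<close>. Comparing it with its adjoint shows that its squared Frobenius norm
  is at least the trace \<open>n\<close> of its square, with equality iff it is Hermitian, which means that \<open>g\<close> is the
  canonical dual. The off-diagonal squared moduli therefore have mean at least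
  \<open>(n * k - n\<^sup>2) / (k\<^sup>2 * (k - 1))\<close>, and the tangent line inequality for \<open>x powr p\<close> at this
  value gives the bound.
\<close>

section \<open>Conjugation and the sesquilinear form\<close>

lemma scnj_zero [simp]: "scnj (0::'a::real_or_complex) = 0"
  using scnj_add[of "0::'a" 0] by simp

text \<open>The class axiom determines the conjugate from the norm, so invariance of the norm,
  involutivity and multiplicativity all reduce to multiplicativity of \<open>norm\<close>. At
  \<open>x = 0\<close> the convention on division by zero gives the right value.\<close>

lemma scnj_eq_divide: "scnj (x::'a::real_or_complex) = of_real ((norm x)\<^sup>2) / x"
  using mult_scnj[of x] by (cases "x = 0") (simp_all add: field_simps of_real_def)

lemma norm_scnj [simp]: "norm (scnj (x::'a::real_or_complex)) = norm x"
  by (cases "x = 0") (simp_all add: scnj_eq_divide norm_divide power2_eq_square norm_mult)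

lemma scnj_scnj [simp]: "scnj (scnj (x::'a::real_or_complex)) = x"
  by (cases "x = 0") (simp_all add: scnj_eq_divide[of "scnj x"], simp add: scnj_eq_divide)

lemma scnj_mult: "scnj ((x::'a::real_or_complex) * y) = scnj x * scnj y"
  by (simp add: scnj_eq_divide norm_mult power_mult_distrib)

lemma scnj_diff: "scnj ((x::'a::real_or_complex) - y) = scnj x - scnj y"
  using scnj_add[of "x - y" y] by simp

lemma scnj_of_nat [simp]: "scnj (of_nat m :: 'a::real_or_complex) = of_nat m"
  by (cases "m = 0") (simp_all add: scnj_eq_divide power2_eq_square)

lemma scnj_sum: "scnj (sum h A) = (\<Sum>i\<in>A. scnj (h i :: 'a::real_or_complex))"
  by (induction A rule: infinite_finite_induct) (simp_all add: scnj_add)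

lemma mult_scnj_of_real: "(x::'a::real_or_complex) * scnj x = of_real ((norm x)\<^sup>2)"
  by (simp add: mult_scnj of_real_def)

lemma hinner_add_left: "hinner (x + y) z = hinner x z + hinner y z"
  by (simp add: hinner_def distrib_right sum.distrib)

lemma hinner_scale_left: "hinner (c *s x) z = c * hinner x z"
  by (simp add: hinner_def sum_distrib_left mult.assoc)

lemma hinner_sum_left: "hinner (\<Sum>i\<in>A. h i) z = (\<Sum>i\<in>A. hinner (h i) z)"
  by (induction A rule: infinite_finite_induct) (simp_all add: hinner_add_left, simp_all add: hinner_def)

lemma scnj_hinner: "scnj (hinner x y) = hinner y x"
  by (simp add: hinner_def scnj_sum scnj_mult mult.commute)

lemma hinner_axis_left: "hinner (axis a 1) y = scnj (y $ a)"
  by (simp add: hinner_def axis_def if_distrib[of "\<lambda>c. c * _"] cong: if_cong)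

section \<open>Frame operator and canonical dual\<close>

lemma hinner_frame_operator:
  "hinner (frame_operator k f v) w = (\<Sum>i=1..k. hinner v (f i) * hinner (f i) w)"
  by (simp add: frame_operator_def hinner_sum_left hinner_scale_left)

lemma frame_operator_self_adjoint:
  "hinner (frame_operator k f v) w = hinner v (frame_operator k f w)"
proof -
  have "hinner v (frame_operator k f w) = scnj (hinner (frame_operator k f w) v)"
    by (simp add: scnj_hinner)
  also have "\<dots> = (\<Sum>i=1..k. hinner (f i) w * hinner v (f i))"
    by (simp add: hinner_frame_operator scnj_sum scnj_mult scnj_hinner)
  finally show ?thesis
    by (simp add: hinner_frame_operator mult.commute)
qed

lemma linear_frame_operator: "Vector_Spaces.linear (*s) (*s) (frame_operator k f)"
  unfolding Vector_Spaces.linear_iff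
  by (simp add: vec.vector_space_axioms frame_operator_def hinner_add_left hinner_scale_left vec.scale_left_distrib
      sum.distrib vec.scale_sum_right)

text \<open>Pairing the image of \<open>v\<close> with \<open>v\<close> gives the sum of squared
  frame coefficients, which the lower frame bound keeps positive for nonzero \<open>v\<close>. So
  the kernel is trivial, and finite dimension turns injectivity into surjectivity.\<close>

lemma bij_frame_operator:
  assumes "is_frame k f"
  shows "bij (frame_operator k f)"
proof -
  obtain A where "0 < A" and A: "\<And>v. A * (norm v)\<^sup>2 \<le> (\<Sum>i=1..k. (norm (hinner v (f i)))\<^sup>2)"
    using assms by (auto simp: is_frame_def)
  have "v = 0" if "frame_operator k f v = 0" for v
  proof -
    have "of_real (\<Sum>i=1..k. (norm (hinner v (f i)))\<^sup>2) = hinner (frame_operator k f v) v"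
      unfolding of_real_sum mult_scnj_of_real[symmetric]
      by (simp add: hinner_frame_operator scnj_hinner)
    also have "\<dots> = 0"
      by (simp add: that hinner_def)
    finally have "A * (norm v)\<^sup>2 \<le> 0"
      using A[of v] by (simp only: of_real_eq_0_iff)
    then show ?thesis
      using \<open>0 < A\<close> by (simp add: mult_le_0_iff)
  qed
  then have "inj (frame_operator k f)"
    using vec.linear_inj_iff_eq_0[OF linear_frame_operator] by blast
  then show ?thesis
    using vec.linear_injective_imp_surjective[OF linear_frame_operator] by (simp add: bij_def)
qed

text \<open>Trades the inverse for an equation that the reconstruction formula and self-adjointness
  can address.\<close>

lemma canonical_dual_iff:
  assumes "is_frame k f"
  shows "g = canonical_dual k f i \<longleftrightarrow> frame_operator k f g = f i"
  unfolding canonical_dual_def using bij_frame_operator[OF assms]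
  by (metis bij_inv_eq_iff)

section \<open>The cross Gram matrix of a dual pair\<close>

lemma trace_dual_frame:
  fixes f g :: "nat \<Rightarrow> 'a::real_or_complex ^ 'n"
  assumes "is_dual_frame k f g"
  shows "(\<Sum>i=1..k. hinner (f i) (g i)) = of_nat CARD('n)"
proof -
  \<comment> \<open>This is the diagonal entry at \<open>a\<close> of the reconstruction operator,
    which is the identity. Summing over \<open>a\<close> and swapping the sums gives the trace of
    the cross Gram matrix.\<close>
  have "(\<Sum>i=1..k. f i $ a * scnj (g i $ a)) = 1" for a
  proof -
    have "axis a 1 = (\<Sum>i=1..k. hinner (axis a 1) (g i) *s f i)"
      using assms by (simp add: is_dual_frame_def)
    then have "(axis a 1 :: 'a ^ 'n) $ a = (\<Sum>i=1..k. hinner (axis a 1) (g i) *s f i) $ a"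
      by simp
    then show ?thesis
      by (simp add: hinner_axis_left mult.commute)
  qed
  then show ?thesis
    unfolding hinner_def by (subst sum.swap) simp
qed

text \<open>Reconstruct \<open>v\<close> from its coefficients against \<open>g\<close>, then pair
  with \<open>w\<close>. The choice \<open>v = f i\<close>, \<open>w = g l\<close> shows that the
  cross Gram matrix equals its own square.\<close>

lemma cross_gram_idempotent:
  assumes "is_dual_frame k f g"
  shows "(\<Sum>j=1..k. hinner v (g j) * hinner (f j) w) = hinner v w"
proof -
  have "v = (\<Sum>j=1..k. hinner v (g j) *s f j)"
    using assms by (simp add: is_dual_frame_def)
  then have "hinner v w = hinner (\<Sum>j=1..k. hinner v (g j) *s f j) w"
    by simp
  then show ?thesis
    by (simp add: hinner_sum_left hinner_scale_left)
qed

text \<open>The left side is the squared Frobenius distance of the cross Gram matrix from its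
  adjoint. Expanding it leaves twice the squared Frobenius norm minus the trace of the square and
  its conjugate; idempotence makes both traces equal to the dimension.\<close>

lemma cross_gram_adjoint_distance:
  fixes f g :: "nat \<Rightarrow> 'a::real_or_complex ^ 'n"
  assumes "is_dual_frame k f g"
  shows "(\<Sum>i=1..k. \<Sum>j=1..k. (norm (hinner (f i) (g j) - hinner (g i) (f j)))\<^sup>2) =
    2 * (\<Sum>i=1..k. \<Sum>j=1..k. (norm (hinner (f i) (g j)))\<^sup>2) - 2 * real CARD('n)"
proof -
  let ?I = "{1..k}"
  define M where "M i j = hinner (f i) (g j)" for i j
  define N where "N = (\<Sum>i\<in>?I. \<Sum>j\<in>?I. (norm (M i j))\<^sup>2)"
  have adj: "hinner (g i) (f j) = scnj (M j i)" for i j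
    by (simp add: M_def scnj_hinner)
  have "(\<Sum>i\<in>?I. \<Sum>j\<in>?I. M i j * M j i) = (\<Sum>i\<in>?I. M i i)"
    using cross_gram_idempotent[OF assms] by (simp add: M_def)
  then have tr: "(\<Sum>i\<in>?I. \<Sum>j\<in>?I. M i j * M j i) = of_nat CARD('n)"
    using trace_dual_frame[OF assms] by (simp add: M_def)
  \<comment> \<open>The second cross term is the conjugate of the first, and conjugation fixes the
    dimension.\<close>
  from arg_cong[OF tr, of scnj]
  have tr': "(\<Sum>i\<in>?I. \<Sum>j\<in>?I. scnj (M i j) * scnj (M j i)) = of_nat CARD('n)"
    by (simp add: scnj_sum scnj_mult)
  have N': "(\<Sum>i\<in>?I. \<Sum>j\<in>?I. (norm (M j i))\<^sup>2) = N"
    unfolding N_def by (rule sum.swap)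
  have entry: "of_real ((norm (M i j - scnj (M j i)))\<^sup>2) =
      of_real ((norm (M i j))\<^sup>2) + of_real ((norm (M j i))\<^sup>2)
        - M i j * M j i - scnj (M i j) * scnj (M j i)" for i j
    unfolding mult_scnj_of_real[symmetric] by (simp add: scnj_diff algebra_simps)
  have "(of_real (\<Sum>i\<in>?I. \<Sum>j\<in>?I. (norm (M i j - scnj (M j i)))\<^sup>2) :: 'a) =
      of_real N + of_real (\<Sum>i\<in>?I. \<Sum>j\<in>?I. (norm (M j i))\<^sup>2)
        - of_nat CARD('n) - of_nat CARD('n)"
    unfolding of_real_sum entry N_def
    by (simp only: sum.distrib sum_subtractf tr tr')
  then have "(of_real (\<Sum>i\<in>?I. \<Sum>j\<in>?I. (norm (M i j - scnj (M j i)))\<^sup>2) :: 'a) =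
      of_real (2 * N - 2 * real CARD('n))"
    unfolding N' by simp
  then show ?thesis
    unfolding of_real_eq_iff by (simp add: adj N_def flip: M_def)
qed

lemma cross_gram_frobenius_ge:
  fixes f g :: "nat \<Rightarrow> 'a::real_or_complex ^ 'n"
  assumes "is_dual_frame k f g"
  shows "real CARD('n) \<le> (\<Sum>i=1..k. \<Sum>j=1..k. (norm (hinner (f i) (g j)))\<^sup>2)"
proof -
  have "0 \<le> (\<Sum>i=1..k. \<Sum>j=1..k. (norm (hinner (f i) (g j) - hinner (g i) (f j)))\<^sup>2)"
    by (intro sum_nonneg) simp
  then show ?thesis
    unfolding cross_gram_adjoint_distance[OF assms] by simp
qed

text \<open>Equality means that the matrix is Hermitian. Then the coefficients of \<open>g i\<close>
  against \<open>f\<close> are those that reconstruct \<open>f i\<close>, so the frame operator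
  sends \<open>g i\<close> to \<open>f i\<close>. The converse is self-adjointness of the frame
  operator.\<close>

lemma cross_gram_frobenius_eq_iff:
  fixes f g :: "nat \<Rightarrow> 'a::real_or_complex ^ 'n"
  assumes "is_frame k f" and dual: "is_dual_frame k f g"
  shows "(\<Sum>i=1..k. \<Sum>j=1..k. (norm (hinner (f i) (g j)))\<^sup>2) = real CARD('n) \<longleftrightarrow>
    (\<forall>i\<in>{1..k}. g i = canonical_dual k f i)"
proof -
  let ?I = "{1..k}"
  have "(\<Sum>i\<in>?I. \<Sum>j\<in>?I. (norm (hinner (f i) (g j)))\<^sup>2) = real CARD('n) \<longleftrightarrow>
      (\<Sum>i\<in>?I. \<Sum>j\<in>?I. (norm (hinner (f i) (g j) - hinner (g i) (f j)))\<^sup>2) = 0"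
    unfolding cross_gram_adjoint_distance[OF dual] by auto
  also have "\<dots> \<longleftrightarrow> (\<forall>i\<in>?I. \<forall>j\<in>?I. hinner (f i) (g j) = hinner (g i) (f j))"
    by (simp add: sum_nonneg_eq_0_iff sum_nonneg)
  also have "\<dots> \<longleftrightarrow> (\<forall>i\<in>?I. frame_operator k f (g i) = f i)"
  proof (intro iffI ballI)
    fix i assume H: "\<forall>i\<in>?I. \<forall>j\<in>?I. hinner (f i) (g j) = hinner (g i) (f j)" and i: "i \<in> ?I"
    have "frame_operator k f (g i) = (\<Sum>j\<in>?I. hinner (f i) (g j) *s f j)"
      unfolding frame_operator_def using H i by (intro sum.cong) auto
    also have "\<dots> = f i"
      using dual by (simp add: is_dual_frame_def)
    finally show "frame_operator k f (g i) = f i" .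
  next
    fix i j assume H: "\<forall>i\<in>?I. frame_operator k f (g i) = f i" and "i \<in> ?I" "j \<in> ?I"
    then show "hinner (f i) (g j) = hinner (g i) (f j)"
      using frame_operator_self_adjoint[of k f "g i" "g j"] by simp
  qed
  also have "\<dots> \<longleftrightarrow> (\<forall>i\<in>?I. g i = canonical_dual k f i)"
    by (simp add: canonical_dual_iff[OF assms(1)])
  finally show ?thesis .
qed

section \<open>Tangent line inequalities for real powers\<close>

lemma powr_gt_tangent_at_1:
  fixes y p :: real
  assumes "0 \<le> y" "1 < p" "y \<noteq> 1"
  shows "1 + p * (y - 1) < y powr p"
proof (cases "y = 0")
  case True
  then show ?thesis using assms by simp
next
  case False
  with assms have y: "0 < y" by simp
  \<comment> \<open>The logarithm lies strictly below its tangent at 1 away from 1. Taking the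
    argument \<open>1 / y\<close> bounds \<open>y * ln y\<close> from below.\<close>
  have "ln (1 / y) < 1 / y - 1"
    using ln_le_minus_one[of "1 / y"] ln_eq_minus_one[of "1 / y"] y \<open>y \<noteq> 1\<close> by force
  then have "y * (1 - 1 / y) < y * ln y"
    using y by (simp add: ln_div)
  then have "y - 1 < y * ln y"
    using y by (simp add: algebra_simps)
  then have "y + (p - 1) * (y - 1) < y + (p - 1) * (y * ln y)"
    using \<open>1 < p\<close> by simp
  also have "\<dots> = y * (1 + (p - 1) * ln y)"
    by (simp add: algebra_simps)
  \<comment> \<open>This is \<open>1 + t \<le> exp t\<close> at
    \<open>t = (p - 1) * ln y\<close>.\<close>
  also have "\<dots> \<le> y * exp ((p - 1) * ln y)"
    using y by (intro mult_left_mono) simp_all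
  also have "\<dots> = y powr p"
    using y by (simp add: powr_def left_diff_distrib exp_diff)
  finally show ?thesis
    by (simp add: algebra_simps)
qed

text \<open>By homogeneity, dividing by \<open>s\<close> moves the point of tangency to 1.\<close>

lemma powr_gt_tangent:
  fixes x s p :: real
  assumes "0 \<le> x" "0 < s" "1 < p" "x \<noteq> s"
  shows "s powr p + p * s powr (p - 1) * (x - s) < x powr p"
proof -
  have "s powr p + p * s powr (p - 1) * (x - s) = s powr p * (1 + p * (x / s - 1))"
    using \<open>0 < s\<close> by (simp add: powr_diff field_simps)
  also have "\<dots> < s powr p * (x / s) powr p"
    using powr_gt_tangent_at_1[of "x / s" p] assms by simp
  also have "\<dots> = x powr p"
    using assms by (simp add: powr_divide)
  finally show ?thesis .
qed

lemma powr_ge_tangent: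
  fixes x s p :: real
  assumes "0 \<le> x" "0 < s" "1 \<le> p"
  shows "s powr p + p * s powr (p - 1) * (x - s) \<le> x powr p"
  using powr_gt_tangent[of x s p] assms
  by (cases "x = s \<or> p = 1") (auto simp: less_le)

text \<open>Sum the tangents at \<open>s\<close>. Their slope is nonnegative, so a total above
  \<open>card A * s\<close> can only raise the sum of the tangents.\<close>

lemma sum_powr_ge:
  fixes x :: "'b \<Rightarrow> real"
  assumes "\<And>a. a \<in> A \<Longrightarrow> 0 \<le> x a" "0 \<le> s" "1 \<le> p"
    and sum: "real (card A) * s \<le> (\<Sum>a\<in>A. x a)"
  shows "real (card A) * s powr p \<le> (\<Sum>a\<in>A. x a powr p)"
\<comment> \<open>The tangent inequality is stated for positive \<open>s\<close>; at zero,
  \<open>0 powr p = 0\<close> reduces the claim to nonnegativity.\<close>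
proof (cases "s = 0")
  case True
  then show ?thesis by (simp add: sum_nonneg)
next
  case False
  have "real (card A) * s powr p
      \<le> real (card A) * s powr p + p * s powr (p - 1) * ((\<Sum>a\<in>A. x a) - real (card A) * s)"
    using assms by simp
  also have "\<dots> = (\<Sum>a\<in>A. s powr p + p * s powr (p - 1) * (x a - s))"
    by (simp add: sum.distrib sum_subtractf flip: sum_distrib_left)
  also have "\<dots> \<le> (\<Sum>a\<in>A. x a powr p)"
    using assms False by (intro sum_mono powr_ge_tangent) simp_all
  finally show ?thesis .
qed

text \<open>For \<open>1 < p\<close> the tangent touches the graph only at \<open>s\<close>, so one
  deviating entry makes the summed inequality strict.\<close>

lemma sum_powr_eqD:
  fixes x :: "'b \<Rightarrow> real"
  assumes "finite A" "\<And>a. a \<in> A \<Longrightarrow> 0 \<le> x a" "0 < s" "1 < p"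
    and sum: "real (card A) * s \<le> (\<Sum>a\<in>A. x a)"
    and eq: "(\<Sum>a\<in>A. x a powr p) = real (card A) * s powr p"
    and "b \<in> A"
  shows "x b = s"
proof (rule ccontr)
  assume "x b \<noteq> s"
  have "real (card A) * s powr p
      \<le> real (card A) * s powr p + p * s powr (p - 1) * ((\<Sum>a\<in>A. x a) - real (card A) * s)"
    using assms by simp
  also have "\<dots> = (\<Sum>a\<in>A. s powr p + p * s powr (p - 1) * (x a - s))"
    by (simp add: sum.distrib sum_subtractf flip: sum_distrib_left)
  also have "\<dots> < (\<Sum>a\<in>A. x a powr p)"
  proof (rule sum_strict_mono_ex1)
    show "\<forall>a\<in>A. s powr p + p * s powr (p - 1) * (x a - s) \<le> x a powr p"
      using assms by (auto intro!: powr_ge_tangent)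
    show "\<exists>a\<in>A. s powr p + p * s powr (p - 1) * (x a - s) < x a powr p"
      using assms \<open>x b \<noteq> s\<close> by (intro bexI[of _ b] powr_gt_tangent) auto
  qed fact
  finally show False
    using eq by simp
qed

section \<open>Diagonal and off-diagonal contributions, and the bound\<close>

lemma sum_square_diagonal:
  fixes h :: "'b \<Rightarrow> 'b \<Rightarrow> 'c::comm_monoid_add"
  assumes "finite I"
  shows "(\<Sum>i\<in>I. \<Sum>j\<in>I. h i j) = (\<Sum>i\<in>I. h i i) + (\<Sum>(i, j)\<in>(SIGMA i:I. I - {i}). h i j)"
proof -
  have "(\<Sum>i\<in>I. \<Sum>j\<in>I. h i j) = (\<Sum>i\<in>I. h i i + (\<Sum>j\<in>I - {i}. h i j))"
    using assms by (intro sum.cong refl sum.remove) auto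
  then show ?thesis
    using assms by (simp add: sum.distrib sum.Sigma)
qed

text \<open>The right side is what the estimate produces: \<open>K\<close> diagonal terms, then
  \<open>K * (K - 1)\<close> off-diagonal terms taken at their least possible mean.\<close>

lemma cross_potential_bound_eq:
  fixes n K p :: real
  assumes "0 < n" "n \<le> K" "1 < K"
  shows "((n * K - n\<^sup>2) powr p + n powr (2 * p) * (K - 1) powr (p - 1)) /
      (K powr (2 * p - 1) * (K - 1) powr (p - 1)) =
    K * ((n / K)\<^sup>2) powr p + K * (K - 1) * ((n * K - n\<^sup>2) / (K\<^sup>2 * (K - 1))) powr p"
proof -
  have sq: "(u\<^sup>2) powr p = u powr (2 * p)" if "0 < u" for u :: real
    using that powr_powr[of u 2 p] by simp
  have nK: "0 \<le> n * K - n\<^sup>2"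
    using assms by (simp add: power2_eq_square mult_left_mono)
  have split: "((n * K - n\<^sup>2) / (K\<^sup>2 * (K - 1))) powr p =
      (n * K - n\<^sup>2) powr p / (K powr (2 * p) * (K - 1) powr p)"
    using assms nK by (simp add: powr_divide powr_mult sq)
  have diag: "((n / K)\<^sup>2) powr p = n powr (2 * p) / K powr (2 * p)"
    using assms by (simp add: sq powr_divide)
  show ?thesis
    unfolding split diag using assms
    by (simp add: powr_diff divide_simps) (simp add: algebra_simps)
qed

text \<open>The condition \<open>2 \<le> k\<close> keeps the divisor \<open>K - 1\<close> positive.
  Equality is split by regime: at \<open>p = 1\<close> the potential is the squared Frobenius norm,
  which cannot detect equal moduli; at \<open>k = CARD('n)\<close> equality makes all off-diagonal
  entries vanish, so no positive \<open>C2\<close> exists.\<close>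

theorem theorem26:
  fixes f g :: "nat \<Rightarrow> 'a::real_or_complex ^ 'n"
    and k :: nat and p C1 :: real
  assumes "2 \<le> k"
    and "is_frame k f"
    and "is_dual_frame k f g"
    and "0 < C1"
    and "\<forall>i\<in>{1..k}. hinner (f i) (g i) = of_real C1"
    and "1 \<le> p"
  shows
    "let n = real CARD('n); K = real k;
         bound = ((n * K - n\<^sup>2) powr p + n powr (2 * p) * (K - 1) powr (p - 1)) /
                 (K powr (2 * p - 1) * (K - 1) powr (p - 1));
         canonical = (\<forall>i\<in>{1..k}. g i = canonical_dual k f i);
         equimodular = (\<exists>C2::real. 0 < C2 \<and>
           (\<forall>i\<in>{1..k}. \<forall>j\<in>{1..k}. i \<noteq> j \<longrightarrow> (norm (hinner (f i) (g j)))\<^sup>2 = C2))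
     in bound \<le> cross_frame_potential p k f g \<and>
        (1 < p \<and> CARD('n) < k \<longrightarrow>
           (cross_frame_potential p k f g = bound \<longleftrightarrow> canonical \<and> equimodular)) \<and>
        (p = 1 \<or> k = CARD('n) \<longrightarrow>
           (cross_frame_potential p k f g = bound \<longleftrightarrow> canonical))"
proof -
  define n K where "n = real CARD('n)" and "K = real k"
  define x where "x i j = (norm (hinner (f i) (g j)))\<^sup>2" for i j
  \<comment> \<open>Off-diagonal pairs form one index set, to which the power sum lemmas apply
    directly.\<close>
  define A where "A = (SIGMA i:{1..k}. {1..k} - {i})"
  define X where "X = (\<Sum>(i, j)\<in>A. x i j)"
  define Y where "Y = (\<Sum>(i, j)\<in>A. x i j powr p)"
  \<comment> \<open>The least Frobenius value \<open>n\<close>, less the diagonal share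
    \<open>K * (n / K)\<^sup>2\<close>, spread evenly over the \<open>K * (K - 1)\<close>
    off-diagonal entries.\<close>
  define s where "s = (n * K - n\<^sup>2) / (K\<^sup>2 * (K - 1))"
  define canonical where "canonical \<longleftrightarrow> (\<forall>i\<in>{1..k}. g i = canonical_dual k f i)"
  define equimodular where "equimodular \<longleftrightarrow>
    (\<exists>C2::real. 0 < C2 \<and> (\<forall>i\<in>{1..k}. \<forall>j\<in>{1..k}. i \<noteq> j \<longrightarrow> x i j = C2))"
  define bound where "bound = ((n * K - n\<^sup>2) powr p + n powr (2 * p) * (K - 1) powr (p - 1)) /
    (K powr (2 * p - 1) * (K - 1) powr (p - 1))"
  note dual = \<open>is_dual_frame k f g\<close>
  have n: "0 < n" by (simp add: n_def)
  have K: "1 < K" using \<open>2 \<le> k\<close> by (simp add: K_def)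
  have nK: "n \<le> K" using \<open>is_frame k f\<close> by (simp add: is_frame_def n_def K_def)
  have s0: "0 \<le> s"
    unfolding s_def using n K nK by (simp add: power2_eq_square mult_left_mono)
  have finA: "finite A" by (simp add: A_def)
  have "card A = k * (k - 1)" by (simp add: A_def)
  then have cardA: "real (card A) = K * (K - 1)"
    using \<open>2 \<le> k\<close> by (simp add: K_def of_nat_diff)
  have "(of_real (K * C1) :: 'a) = (\<Sum>i=1..k. hinner (f i) (g i))"
    using assms(5) by (simp add: K_def)
  also have "\<dots> = of_real n"
    unfolding trace_dual_frame[OF dual] by (simp add: n_def)
  finally have "K * C1 = n"
    by (simp only: of_real_eq_iff)
  then have C1: "C1 = n / K"
    using K by (simp add: field_simps)
  have diag: "x i i = (n / K)\<^sup>2" if "i \<in> {1..k}" for i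
    using assms(5) that by (simp add: x_def C1 norm_divide power_divide)
  have frob: "(\<Sum>i=1..k. \<Sum>j=1..k. x i j) = K * (n / K)\<^sup>2 + X"
    unfolding X_def A_def by (subst sum_square_diagonal) (simp_all add: diag K_def)
  have card_s: "real (card A) * s = n - K * (n / K)\<^sup>2"
    unfolding cardA s_def using K by (simp add: field_simps power2_eq_square)
  have X_ge: "real (card A) * s \<le> X"
    using cross_gram_frobenius_ge[OF dual] frob unfolding card_s by (simp add: n_def x_def)
  \<comment> \<open>The diagonal share is fixed, so the Frobenius norm is minimal exactly when the
    off-diagonal sum is.\<close>
  have canonical_iff: "canonical \<longleftrightarrow> X = real (card A) * s"
    using cross_gram_frobenius_eq_iff[OF \<open>is_frame k f\<close> dual] frob
    unfolding card_s canonical_def by (auto simp: n_def x_def)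
  have "norm z powr (2 * p) = ((norm z)\<^sup>2) powr p" for z :: 'a
    using powr_powr[of "norm z" 2 p] by (cases "z = 0") simp_all
  then have "cross_frame_potential p k f g = (\<Sum>i=1..k. \<Sum>j=1..k. x i j powr p)"
    by (simp add: cross_frame_potential_def x_def)
  also have "\<dots> = K * ((n / K)\<^sup>2) powr p + Y"
    unfolding Y_def A_def by (subst sum_square_diagonal) (simp_all add: diag K_def)
  finally have pot: "cross_frame_potential p k f g = K * ((n / K)\<^sup>2) powr p + Y" .
  have bound: "bound = K * ((n / K)\<^sup>2) powr p + real (card A) * s powr p"
    unfolding bound_def cardA s_def by (rule cross_potential_bound_eq[OF n nK K])
  have x0: "0 \<le> x i j" for i j
    by (simp add: x_def)
  have Y_ge: "real (card A) * s powr p \<le> Y"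
    unfolding Y_def case_prod_beta using X_ge s0 \<open>1 \<le> p\<close>
    by (intro sum_powr_ge) (simp_all add: x0 X_def case_prod_beta)
  have eq_iff: "cross_frame_potential p k f g = bound \<longleftrightarrow> Y = real (card A) * s powr p"
    by (simp add: pot bound)
  have strict: "Y = real (card A) * s powr p \<longleftrightarrow> canonical \<and> equimodular"
    if "1 < p" "CARD('n) < k"
  proof
    \<comment> \<open>Strictness makes \<open>s\<close> positive, so that it admits the tangent
      inequality and can serve as the witness \<open>C2\<close>.\<close>
    have "n < K" using that by (simp add: n_def K_def)
    then have s: "0 < s"
      unfolding s_def using n K by (simp add: power2_eq_square)
    assume Y: "Y = real (card A) * s powr p"
    have "(case a of (i, j) \<Rightarrow> x i j) = s" if "a \<in> A" for a
    proof (rule sum_powr_eqD[OF finA _ s \<open>1 < p\<close> _ _ that])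
      show "real (card A) * s \<le> (\<Sum>(i, j)\<in>A. x i j)"
        using X_ge by (simp add: X_def)
      show "(\<Sum>a\<in>A. (case a of (i, j) \<Rightarrow> x i j) powr p) = real (card A) * s powr p"
        using Y by (simp add: Y_def case_prod_beta)
    qed (auto simp: x0)
    then have xs: "\<And>i j. (i, j) \<in> A \<Longrightarrow> x i j = s"
      by fastforce
    then have "X = (\<Sum>(i, j)\<in>A. s)"
      unfolding X_def by (intro sum.cong) auto
    then have canonical
      by (simp add: canonical_iff)
    moreover have equimodular
      unfolding equimodular_def using s xs by (intro exI[of _ s]) (auto simp: A_def)
    ultimately show "canonical \<and> equimodular" ..
  next
    assume "canonical \<and> equimodular"
    then obtain C2 where X: "X = real (card A) * s" and C2: "\<And>i j. (i, j) \<in> A \<Longrightarrow> x i j = C2"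
      by (auto simp: canonical_iff equimodular_def A_def)
    \<comment> \<open>Both sums have constant terms, so cancelling the nonzero \<open>card A\<close>
      in \<open>X = card A * s\<close> identifies \<open>C2\<close> with \<open>s\<close>.\<close>
    have "X = (\<Sum>(i, j)\<in>A. C2)" "Y = (\<Sum>(i, j)\<in>A. C2 powr p)"
      unfolding X_def Y_def by (rule sum.cong; auto simp: C2)+
    moreover have "real (card A) \<noteq> 0"
      unfolding cardA using K by simp
    ultimately show "Y = real (card A) * s powr p"
      using X by simp
  qed
  \<comment> \<open>For \<open>p = 1\<close> the sums \<open>X\<close> and \<open>Y\<close>
    coincide. For \<open>k = CARD('n)\<close> the value \<open>s\<close> is zero, and
    \<open>X\<close> and \<open>Y\<close>, having nonnegative terms, vanish together.\<close>
  have degenerate: "Y = real (card A) * s powr p \<longleftrightarrow> canonical" if "p = 1 \<or> k = CARD('n)"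
  proof (cases "p = 1")
    case True
    then show ?thesis
      using s0 by (simp add: canonical_iff X_def Y_def x0)
  next
    case False
    with that have "K = n" by (simp add: K_def n_def)
    then have "s = 0"
      by (simp add: s_def power2_eq_square)
    have "Y = 0 \<longleftrightarrow> X = 0"
      unfolding X_def Y_def case_prod_beta by (simp add: sum_nonneg_eq_0_iff finA x0)
    then show ?thesis
      by (simp add: canonical_iff \<open>s = 0\<close>)
  qed
  have "bound \<le> cross_frame_potential p k f g \<and>
      (1 < p \<and> CARD('n) < k \<longrightarrow>
         (cross_frame_potential p k f g = bound \<longleftrightarrow> canonical \<and> equimodular)) \<and>
      (p = 1 \<or> k = CARD('n) \<longrightarrow> (cross_frame_potential p k f g = bound \<longleftrightarrow> canonical))"
    using Y_ge strict degenerate unfolding eq_iff by (simp add: pot bound)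
  then show ?thesis
    unfolding Let_def bound_def canonical_def equimodular_def x_def n_def K_def .
qed

end
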